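(* Let $u_0\ge 0$ and let $E^*\subseteq E'\subseteq E$ be such that $E'$ is acyclic and for every $v\in V$ there is a directed path from $s$ to $v$ using only edges of $E'$. Then there exists a normalized thin flow of value $u_0$ with resetting on $E^*\subseteq E'$.
   Context: $G=(V,E)$ is a finite directed graph without loops and with at most one edge from $v$ to $w$ for every pair of nodes; an edge from $v$ to $w$ is written $e=vw$. A source $s\in V$ and a sink $t\in V$, $s\ne t$, are given, together with positive numbers $(\nu_e)_{e\in E}$. Let $u_0\ge 0$ and $E^*\subseteq E'\subseteq E$, with $E'$ acyclic and containing an $s$-$v$ path for every $v\in V$. $K(E',u_0)$ denotes the set of static $s$-$t$ flows of size $u_0$ supported on $E'$: vectors $x'=(x'_e)_{e\in E}$ with $x'_e\ge 0$, $x'_e=0$ for $e\notin E'$, and $\sum_{e\in\delta^+(v)}x'_e-\sum_{e\in\delta^-(v)}x'_e$ equal to $u_0$ for $v=s$, to $-u_0$ for $v=t$, and to $0$ for all other $v$ (here $\delta^+(v),\delta^-(v)$ are the sets of edges leaving and entering $v$). For $e=vw\in E'$ and real numbers $a,b$ set $\rho_e(a,b)=b/\nu_e$ if $e\in E^*$, and $\rho_e(a,b)=\max\{a,b/\nu_e\}$ if $e\notin E^*$. The labels corresponding to $x'\in K(E',u_0)$ are the unique numbers $(\ell'_v)_{v\in V}$ with $\ell'_s=1$ and $\ell'_w=\min_{e=vw\in E'}\rho_e(\ell'_v,x'_e)$ for $w\neq s$ (well defined since $E'$ is acyclic). A flow $x'\in K(E',u_0)$ with labels $\ell'$ is a normalized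 thin flow (NTF) of value $u_0$ with resetting on $E^*\subseteq E'$ if $x'_e=0$ for every edge $e=vw\in E'$ such that $\ell'_w<\rho_e(\ell'_v,x'_e)$. *)

theory Defs
  imports "HOL-Analysis.Analysis" "Graph_Theory.Arc_Walk"
begin

text \<open>
  Vectors indexed by the edges are functions on the whole edge type; flows supported on \<open>E'\<close>
  vanish everywhere outside \<open>E'\<close>.
\<close>

abbreviation edge_subgraph :: "('a, 'b) pre_digraph \<Rightarrow> 'b set \<Rightarrow> ('a, 'b) pre_digraph" where
  "edge_subgraph G E' \<equiv> G\<lparr>arcs := E'\<rparr>"

definition acyclic_digraph :: "('a, 'b) pre_digraph \<Rightarrow> bool" where
  "acyclic_digraph H \<longleftrightarrow> (\<nexists>p. pre_digraph.cycle H p)"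

definition static_flows ::
    "('a, 'b) pre_digraph \<Rightarrow> 'a \<Rightarrow> 'a \<Rightarrow> 'b set \<Rightarrow> real \<Rightarrow> ('b \<Rightarrow> real) set" where
  "static_flows G s t E' u0 =
     {x. (\<forall>e\<in>arcs G. 0 \<le> x e) \<and> (\<forall>e. e \<notin> E' \<longrightarrow> x e = 0) \<and>
         (\<forall>v\<in>verts G. (\<Sum>e\<in>out_arcs G v. x e) - (\<Sum>e\<in>in_arcs G v. x e) =
            (if v = s then u0 else if v = t then - u0 else 0))}"

definition edge_label :: "('b \<Rightarrow> real) \<Rightarrow> 'b set \<Rightarrow> 'b \<Rightarrow> real \<Rightarrow> real \<Rightarrow> real" where
  "edge_label \<nu> Estar e a b = (if e \<in> Estar then b / \<nu> e else max a (b / \<nu> e))"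

text \<open>
  Only the values of \<open>l\<close> on the vertices matter. The minimum is over a nonempty finite set
  whenever every vertex is reachable from \<open>s\<close> in \<open>E'\<close>.
\<close>

definition is_labels ::
    "('a, 'b) pre_digraph \<Rightarrow> ('b \<Rightarrow> real) \<Rightarrow> 'a \<Rightarrow> 'b set \<Rightarrow> 'b set \<Rightarrow> ('b \<Rightarrow> real) \<Rightarrow> ('a \<Rightarrow> real) \<Rightarrow> bool"
where
  "is_labels G \<nu> s Estar E' x l \<longleftrightarrow>
     l s = 1 \<and>
     (\<forall>w\<in>verts G - {s}.
        l w = (MIN e\<in>in_arcs (edge_subgraph G E') w. edge_label \<nu> Estar e (l (tail G e)) (x e)))"

definition normalized_thin_flow ::
    "('a, 'b) pre_digraph \<Rightarrow> ('b \<Rightarrow> real) \<Rightarrow> 'a \<Rightarrow> 'a \<Rightarrow> real \<Rightarrow> 'b set \<Rightarrow> 'b set \<Rightarrow> ('b \<Rightarrow> real) \<Rightarrow> bool"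
where
  "normalized_thin_flow G \<nu> s t u0 Estar E' x \<longleftrightarrow>
     x \<in> static_flows G s t E' u0 \<and>
     (\<exists>l. is_labels G \<nu> s Estar E' x l \<and>
        (\<forall>e\<in>E'. l (head G e) < edge_label \<nu> Estar e (l (tail G e)) (x e) \<longrightarrow> x e = 0))"

text \<open>
  The labels exist and are unique on the vertices, so the existential quantifier over \<open>l\<close> above
  refers to \<^emph>\<open>the\<close> labels of \<open>x\<close>.
\<close>

lemma labels_well_defined:
  assumes G: "digraph G" and "E' \<subseteq> arcs G" and ac: "acyclic_digraph (edge_subgraph G E')"
  shows "\<exists>l. is_labels G \<nu> s Estar E' x l \<and>
           (\<forall>l'. is_labels G \<nu> s Estar E' x l' \<longrightarrow> (\<forall>v\<in>verts G. l' v = l v))"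
proof -
  define H where "H = edge_subgraph G E'"
  interpret G: digraph G by fact
  interpret H: fin_digraph H
    using assms(2) finite_subset[OF assms(2)] by unfold_locales (auto simp: H_def)
  have "acyclic (arcs_ends H)"
    unfolding acyclic_def
  proof (intro allI notI)
    fix v assume "(v, v) \<in> (arcs_ends H)\<^sup>+"
    then obtain p where "H.awalk v p v" "p \<noteq> []"
      using H.reachable1_awalk by blast
    then have "H.closed_w p" by (auto simp: H.closed_w_def)
    then obtain c where "H.cycle c" using H.closed_w_imp_cycle by blast
    then show False using ac by (auto simp: acyclic_digraph_def H_def)
  qed
  moreover have "finite (arcs_ends H)" by (simp add: arcs_ends_def)
  ultimately have wf: "wf (arcs_ends H)" by (rule finite_acyclic_wf[rotated])
  have arcD: "(tail G e, v) \<in> arcs_ends H" "tail G e \<in> verts G" if "e \<in> in_arcs H v" for e v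
    using that assms(2) by (force simp: arcs_ends_def arc_to_ends_def H_def)+
  define F where "F = (\<lambda>l w. if w = s then 1 else
    (MIN e\<in>in_arcs H w. edge_label \<nu> Estar e (l (tail G e)) (x e)))"
  define l where "l = wfrec (arcs_ends H) F"
  have "l w = F l w" for w
  proof -
    have "l w = F (cut l (arcs_ends H) w) w"
      unfolding l_def by (rule wfrec[OF wf])
    also have "\<dots> = F l w"
      by (auto simp: F_def cut_apply arcD intro!: arg_cong[where f = Min] image_cong)
    finally show ?thesis .
  qed
  then have l: "is_labels G \<nu> s Estar E' x l"
    by (auto simp: is_labels_def F_def H_def[symmetric])
  have "l' v = l v" if l': "is_labels G \<nu> s Estar E' x l'" and "v \<in> verts G" for l' v
    using wf \<open>v \<in> verts G\<close>
  proof (induction v rule: wf_induct_rule)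
    case (less v)
    then have "l' (tail G e) = l (tail G e)" if "e \<in> in_arcs H v" for e
      using arcD[OF that] by blast
    then show ?case
      using l l' less.prems unfolding is_labels_def H_def[symmetric]
      by (cases "v = s") (auto intro!: arg_cong[where f = Min] image_cong)
  qed
  with l show ?thesis by blast
qed

end

theory Submission
  imports Defs
begin

text \<open>
  A thin flow is the solution of a complementarity problem on a cube: labels \<open>l\<close> are paired with the
  flow balance at the vertices, and rates \<open>\<theta> e \<in> {0..1}\<close> with the label differences along arcs, where
  the flow is \<open>x e = \<nu> e * \<theta> e * l (head e)\<close>. Continuous complementarity problems on a cube are solvable
  by Kuhn's combinatorial lemma. Since \<open>E'\<close> is acyclic no arc can carry more than \<open>u0\<close>, which bounds
  the labels, so for a large enough cube the upper bounds on labels are not active and flow is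
  conserved. Vertices without flow may receive too small a label, but replacing \<open>l\<close> by the true labels
  changes nothing on the arcs that carry flow.
\<close>

section \<open>Complementarity problems on the unit cube\<close>

lemma tendsto_coordinatewise:
  fixes f :: "'c \<Rightarrow> 'i \<Rightarrow> 'b::topological_space"
  shows "(f \<longlongrightarrow> l) F \<longleftrightarrow> (\<forall>i. ((\<lambda>c. f c i) \<longlongrightarrow> l i) F)"
  using limitin_componentwise[of "\<lambda>_. euclidean" UNIV f l F]
  by (simp add: euclidean_product_topology)

text \<open>Tychonoff's theorem for the product topology that functions carry.\<close>

lemma compact_unit_cube_fun: "compact {x :: 'i \<Rightarrow> real. \<forall>i. x i \<in> {0..1}}"
proof -
  have "compactin (product_topology (\<lambda>_. euclidean) UNIV) (PiE UNIV (\<lambda>_::'i. {0..1::real}))"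
    by (subst compactin_PiE) auto
  moreover have "PiE UNIV (\<lambda>_::'i. {0..1::real}) = {x. \<forall>i. x i \<in> {0..1}}"
    by (auto simp: PiE_def extensional_def)
  ultimately show ?thesis
    by (simp add: euclidean_product_topology)
qed

text \<open>
  Kuhn's lemma is applied to the labelling that records the sign of \<open>g i\<close>, forced on the faces of the
  cube. It is preferred to Brouwer's theorem because it does not tie the dimension to a type.
\<close>

lemma approximate_cube_complementarity:
  fixes g :: "nat \<Rightarrow> (nat \<Rightarrow> real) \<Rightarrow> real" and n m :: nat
  shows "\<exists>z. (\<forall>j. z j \<in> {0..1}) \<and> (\<forall>i<n. \<exists>a b.
    (\<forall>j. \<bar>a j - z j\<bar> \<le> 1 / real (Suc m)) \<and> (a i = 0 \<or> 0 < g i a) \<and>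
    (\<forall>j. \<bar>b j - z j\<bar> \<le> 1 / real (Suc m)) \<and> (b i = 1 \<or> g i b \<le> 0))"
proof -
  define pt where "pt q = (\<lambda>j. if j < n then real (q j) / real (Suc m) else 0)" for q :: "nat \<Rightarrow> nat"
  define label where "label q i =
    (if q i = 0 \<or> (q i \<noteq> Suc m \<and> 0 < g i (pt q)) then 0 else 1::nat)" for q i
  obtain q where q: "\<forall>i<n. q i < Suc m" and
    rs: "\<forall>i<n. \<exists>r s. (\<forall>j<n. q j \<le> r j \<and> r j \<le> q j + 1) \<and>
           (\<forall>j<n. q j \<le> s j \<and> s j \<le> q j + 1) \<and> label r i \<noteq> label s i"
    by (rule kuhn_lemma[of "Suc m" n label]) (auto simp: label_def)
  have close: "\<bar>pt r j - pt q j\<bar> \<le> 1 / real (Suc m)" if "\<forall>j<n. q j \<le> r j \<and> r j \<le> q j + 1" for r j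
  proof (cases "j < n")
    case True
    with that have "q j \<le> r j" "r j \<le> q j + 1" by auto
    then show ?thesis
      using True by (auto simp: pt_def simp flip: diff_divide_distrib intro!: divide_right_mono)
  qed (simp add: pt_def)
  have lab0: "pt r i = 0 \<or> 0 < g i (pt r)" if "label r i = 0" for r i
    using that by (auto simp: label_def pt_def split: if_splits)
  have lab1: "pt r i = 1 \<or> g i (pt r) \<le> 0" if "label r i \<noteq> 0" "i < n" for r i
    using that by (auto simp: label_def pt_def split: if_splits)
  show ?thesis
  proof (rule exI[of _ "pt q"], intro conjI allI impI)
    show "pt q j \<in> {0..1}" for j
      using q by (auto simp: pt_def less_Suc_eq_le field_simps)
    fix i assume i: "i < n"
    obtain r s where r: "\<forall>j<n. q j \<le> r j \<and> r j \<le> q j + 1"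
      and s: "\<forall>j<n. q j \<le> s j \<and> s j \<le> q j + 1" and ne: "label r i \<noteq> label s i"
      using rs i by blast
    show "\<exists>a b. (\<forall>j. \<bar>a j - pt q j\<bar> \<le> 1 / real (Suc m)) \<and> (a i = 0 \<or> 0 < g i a) \<and>
       (\<forall>j. \<bar>b j - pt q j\<bar> \<le> 1 / real (Suc m)) \<and> (b i = 1 \<or> g i b \<le> 0)"
    proof (cases "label r i = 0")
      case True
      then show ?thesis
        using close[OF r] close[OF s] lab0[of r i] lab1[of s i] ne i
        by (intro exI[of _ "pt r"] exI[of _ "pt s"]) auto
    next
      case False
      moreover from this ne have "label s i = 0" by (auto simp: label_def split: if_splits)
      ultimately show ?thesis
        using close[OF r] close[OF s] lab0[of s i] lab1[of r i] i
        by (intro exI[of _ "pt s"] exI[of _ "pt r"]) auto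
    qed
  qed
qed

text \<open>As the mesh shrinks, the witnesses \<open>a\<close> and \<open>b\<close> converge to the
  same limit as \<open>z\<close>, and by continuity their sign conditions become weak inequalities
  there.\<close>

lemma cube_complementarity_nat:
  fixes g :: "nat \<Rightarrow> (nat \<Rightarrow> real) \<Rightarrow> real"
  assumes cont: "\<And>i. i < n \<Longrightarrow> continuous_on UNIV (g i)"
  obtains x where "\<And>i. x i \<in> {0..1}"
    and "\<And>i. i < n \<Longrightarrow> 0 < x i \<Longrightarrow> 0 \<le> g i x"
    and "\<And>i. i < n \<Longrightarrow> x i < 1 \<Longrightarrow> g i x \<le> 0"
proof -
  obtain z where z: "\<And>m j. z m j \<in> {0..1}"
    and ab: "\<And>m i. i < n \<Longrightarrow> \<exists>a b.
    (\<forall>j. \<bar>a j - z m j\<bar> \<le> 1 / real (Suc m)) \<and> (a i = 0 \<or> 0 < g i a) \<and>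
    (\<forall>j. \<bar>b j - z m j\<bar> \<le> 1 / real (Suc m)) \<and> (b i = 1 \<or> g i b \<le> 0)"
    using approximate_cube_complementarity[of n _ g] by metis
  \<comment> \<open>With the countable index type \<open>nat\<close> the function space is first
    countable, so compactness yields convergent subsequences.\<close>
  have "seq_compact {x :: nat \<Rightarrow> real. \<forall>i. x i \<in> {0..1}}"
    by (intro compact_imp_seq_compact compact_unit_cube_fun)
  then obtain x h where x: "\<forall>i. x i \<in> {0..1}" and h: "strict_mono (h :: nat \<Rightarrow> nat)"
    and lim: "(z \<circ> h) \<longlonglongrightarrow> x"
    by (rule seq_compactE[where f = z]) (use z in auto)
  have err: "(\<lambda>k. 1 / real (Suc (h k))) \<longlonglongrightarrow> 0"
    using LIMSEQ_subseq_LIMSEQ[OF lim_inverse_n' h] LIMSEQ_subseq_LIMSEQ[OF LIMSEQ_Suc[OF lim_inverse_n'] h]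
    by (simp add: o_def)
  have near: "c \<longlonglongrightarrow> x" if "\<And>k j. \<bar>c k j - z (h k) j\<bar> \<le> 1 / real (Suc (h k))" for c
    unfolding tendsto_coordinatewise
  proof
    fix j
    have "(\<lambda>k. c k j - z (h k) j) \<longlonglongrightarrow> 0"
      by (rule Lim_null_comparison[OF _ err]) (use that in auto)
    moreover have "(\<lambda>k. z (h k) j) \<longlonglongrightarrow> x j"
      using lim by (simp add: tendsto_coordinatewise o_def)
    ultimately show "(\<lambda>k. c k j) \<longlonglongrightarrow> x j"
      using tendsto_add by fastforce
  qed
  have "(0 < x i \<longrightarrow> 0 \<le> g i x) \<and> (x i < 1 \<longrightarrow> g i x \<le> 0)" if i: "i < n" for i
  proof -
    obtain a b where a: "\<And>k j. \<bar>a k j - z (h k) j\<bar> \<le> 1 / real (Suc (h k))"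
        "\<And>k. a k i = 0 \<or> 0 < g i (a k)"
      and b: "\<And>k j. \<bar>b k j - z (h k) j\<bar> \<le> 1 / real (Suc (h k))"
        "\<And>k. b k i = 1 \<or> g i (b k) \<le> 0"
      using ab[OF i, of "h _"] by metis
    have lims: "(\<lambda>k. g i (c k)) \<longlonglongrightarrow> g i x" "(\<lambda>k. c k i) \<longlonglongrightarrow> x i" if "c \<longlonglongrightarrow> x" for c
      using continuous_on_tendsto_compose[OF cont[OF i] that] that
      by (auto simp: tendsto_coordinatewise)
    note A = lims[OF near[OF a(1)]] and B = lims[OF near[OF b(1)]]
    show ?thesis
    proof (intro conjI impI)
      \<comment> \<open>Near a positive limit the alternative \<open>a k i = 0\<close> is excluded,
        so only the sign condition remains. The other half uses \<open>b\<close> and the face at 1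
        in the same way.\<close>
      assume "0 < x i"
      with order_tendstoD(1)[OF A(2)] have "\<forall>\<^sub>F k in sequentially. 0 < a k i" by blast
      then have "\<forall>\<^sub>F k in sequentially. 0 \<le> g i (a k)"
        by eventually_elim (metis a(2) less_imp_le less_irrefl)
      then show "0 \<le> g i x"
        using A(1) by (intro tendsto_lowerbound) auto
    next
      assume "x i < 1"
      with order_tendstoD(2)[OF B(2)] have "\<forall>\<^sub>F k in sequentially. b k i < 1" by blast
      then have "\<forall>\<^sub>F k in sequentially. g i (b k) \<le> 0"
        by eventually_elim (metis b(2) less_irrefl)
      then show "g i x \<le> 0"
        using B(1) by (intro tendsto_upperbound) auto
    qed
  qed
  with x that show thesis by blast
qed

text \<open>Transfer to an arbitrary finite index set along an enumeration.\<close>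

lemma cube_complementarity:
  fixes g :: "'i \<Rightarrow> ('i \<Rightarrow> real) \<Rightarrow> real"
  assumes "finite I" and cont: "\<And>i. i \<in> I \<Longrightarrow> continuous_on UNIV (g i)"
  obtains x where "\<And>i. x i \<in> {0..1}"
    and "\<And>i. i \<in> I \<Longrightarrow> 0 < x i \<Longrightarrow> 0 \<le> g i x"
    and "\<And>i. i \<in> I \<Longrightarrow> x i < 1 \<Longrightarrow> g i x \<le> 0"
proof -
  obtain h where h: "bij_betw h {..<card I} I"
    using \<open>finite I\<close> ex_bij_betw_nat_finite lessThan_atLeast0 by metis
  define idx where "idx = inv_into {..<card I} h"
  \<comment> \<open>An index outside \<open>I\<close> reads some arbitrary coordinate of
    \<open>y\<close>; this is harmless because all coordinates of \<open>y\<close> lie in the unit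
    interval.\<close>
  define expand where "expand y = (\<lambda>i. y (idx i))" for y :: "nat \<Rightarrow> real"
  have "continuous_on UNIV expand"
    unfolding expand_def by (intro continuous_intros continuous_on_product_coordinates)
  moreover have "h k \<in> I" if "k < card I" for k
    using h that by (auto simp: bij_betw_def)
  ultimately have "continuous_on UNIV (\<lambda>y. g (h k) (expand y))" if "k < card I" for k
    using continuous_on_compose2[OF cont _ subset_UNIV] that by blast
  then obtain y where y: "\<And>k. y k \<in> {0..1}"
    "\<And>k. k < card I \<Longrightarrow> 0 < y k \<Longrightarrow> 0 \<le> g (h k) (expand y)"
    "\<And>k. k < card I \<Longrightarrow> y k < 1 \<Longrightarrow> g (h k) (expand y) \<le> 0"
    using cube_complementarity_nat[where g = "\<lambda>k y. g (h k) (expand y)"] by metis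
  have "idx i < card I" "h (idx i) = i" if "i \<in> I" for i
    using h that unfolding idx_def
    by (metis bij_betw_def inv_into_into lessThan_iff, metis bij_betw_inv_into_right)
  then have "\<And>i. i \<in> I \<Longrightarrow> 0 < expand y i \<Longrightarrow> 0 \<le> g i (expand y)"
    and "\<And>i. i \<in> I \<Longrightarrow> expand y i < 1 \<Longrightarrow> g i (expand y) \<le> 0"
    and "\<And>i. expand y i \<in> {0..1}"
    using y(2,3)[of "idx _"] y(1) by (force simp: expand_def)+
  then show thesis
    by (rule that[rotated])
qed

section \<open>Arc sums and flow bounds in acyclic networks\<close>

lemma (in fin_digraph) sum_out_arcs:
  assumes "finite B"
  shows "(\<Sum>v\<in>B. \<Sum>e\<in>out_arcs G v. f e) = (\<Sum>e\<in>{e \<in> arcs G. tail G e \<in> B}. f e)"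
proof -
  have "{e \<in> arcs G. tail G e \<in> B} = (\<Union>v\<in>B. out_arcs G v)" by auto
  then show ?thesis
    using assms by (simp, subst sum.UNION_disjoint) auto
qed

lemma (in fin_digraph) sum_in_arcs:
  assumes "finite B"
  shows "(\<Sum>v\<in>B. \<Sum>e\<in>in_arcs G v. f e) = (\<Sum>e\<in>{e \<in> arcs G. head G e \<in> B}. f e)"
proof -
  have "{e \<in> arcs G. head G e \<in> B} = (\<Union>v\<in>B. in_arcs G v)" by auto
  then show ?thesis
    using assms by (simp, subst sum.UNION_disjoint) auto
qed

locale thin_flow_network = digraph G for G :: "('a, 'b) pre_digraph" +
  fixes s t :: 'a and \<nu> :: "'b \<Rightarrow> real" and u0 :: real and Estar E' :: "'b set"
  assumes s_in: "s \<in> verts G" and t_in: "t \<in> verts G" and s_neq_t: "s \<noteq> t"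
    and \<nu>_pos: "e \<in> arcs G \<Longrightarrow> 0 < \<nu> e"
    and u0_nonneg: "0 \<le> u0"
    and Estar_sub: "Estar \<subseteq> E'" and E'_sub: "E' \<subseteq> arcs G"
    and acyclic_E': "acyclic_digraph (edge_subgraph G E')"
    and apath_from_s: "v \<in> verts G \<Longrightarrow> \<exists>p. pre_digraph.apath (edge_subgraph G E') s p v"
begin

abbreviation "H \<equiv> edge_subgraph G E'"

sublocale H: fin_digraph H
  using E'_sub finite_subset[OF E'_sub] by unfold_locales auto

lemma finite_E': "finite E'"
  using E'_sub finite_arcs by (rule finite_subset)

lemma acyclic_arcs_ends: "acyclic (arcs_ends H)"
  unfolding acyclic_def
proof (intro allI notI)
  fix v assume "(v, v) \<in> (arcs_ends H)\<^sup>+"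
  then obtain p where "H.awalk v p v" "p \<noteq> []"
    using H.reachable1_awalk by blast
  then show False
    using H.closed_w_imp_cycle acyclic_E' unfolding H.closed_w_def acyclic_digraph_def by blast
qed

lemma wf_arcs_ends: "wf (arcs_ends H)"
  by (rule finite_acyclic_wf[OF _ acyclic_arcs_ends]) (simp add: arcs_ends_def finite_E')

lemma arc_ends: "e \<in> E' \<Longrightarrow> (tail G e, head G e) \<in> arcs_ends H"
  by (force simp: arcs_ends_def arc_to_ends_def)

lemma arcs_endsE:
  assumes "(v, w) \<in> arcs_ends H"
  obtains e where "e \<in> E'" "tail G e = v" "head G e = w"
  using assms by (auto simp: arcs_ends_def arc_to_ends_def)

lemma ends_in_verts: "e \<in> E' \<Longrightarrow> tail G e \<in> verts G" "e \<in> E' \<Longrightarrow> head G e \<in> verts G"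
  using E'_sub by auto

lemma rtrancl_from_s: "v \<in> verts G \<Longrightarrow> (s, v) \<in> (arcs_ends H)\<^sup>*"
  using apath_from_s H.reachable_apath reachable_rtranclI by metis

lemma rtrancl_in_verts: "(v, w) \<in> (arcs_ends H)\<^sup>* \<Longrightarrow> v \<in> verts G \<Longrightarrow> w \<in> verts G"
  by (induction rule: rtrancl_induct) (auto elim!: arcs_endsE intro: ends_in_verts)

text \<open>An arc into \<open>s\<close> would close a cycle, because its tail is reachable from
  \<open>s\<close>.\<close>

lemma head_neq_s: "e \<in> E' \<Longrightarrow> head G e \<noteq> s"
  using acyclic_arcs_ends arc_ends rtrancl_from_s[OF ends_in_verts(1)]
  unfolding acyclic_def by (metis rtrancl_into_trancl1)

lemma in_arc_exists:
  assumes "v \<in> verts G" "v \<noteq> s"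
  obtains e where "e \<in> E'" "head G e = v"
  using rtrancl_from_s[OF assms(1)] assms(2) by (metis rtranclE arcs_endsE)

text \<open>
  The head of an arc has a set of descendants that \<open>E'\<close> never leaves, so everything entering this set
  must be absorbed there, and only \<open>t\<close> absorbs flow.
\<close>

lemma flow_le_u0:
  assumes nonneg: "\<And>e. 0 \<le> x e" and supp: "\<And>e. e \<notin> E' \<Longrightarrow> x e = 0"
    and excess: "\<And>v. v \<in> verts G \<Longrightarrow> v \<noteq> s \<Longrightarrow>
      (\<Sum>e\<in>in_arcs G v. x e) \<le> (\<Sum>e\<in>out_arcs G v. x e) + (if v = t then u0 else 0)"
    and e: "e \<in> E'"
  shows "x e \<le> u0"
proof -
  define B where "B = {v. (head G e, v) \<in> (arcs_ends H)\<^sup>*}"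
  have "B \<subseteq> verts G"
    using rtrancl_in_verts ends_in_verts(2)[OF e] by (auto simp: B_def)
  then have fin: "finite B"
    by (rule finite_subset) simp
  have tail_notin: "tail G e \<notin> B"
    using acyclic_arcs_ends rtrancl_into_trancl2[OF arc_ends[OF e]]
    by (auto simp: acyclic_def B_def)
  have closed: "head G a \<in> B" if "a \<in> E'" "tail G a \<in> B" for a
    using that arc_ends[OF that(1)] by (auto simp: B_def intro: rtrancl_into_rtrancl)
  have "s \<notin> B"
  proof
    assume "s \<in> B"
    then have "(head G e, s) \<in> (arcs_ends H)\<^sup>*" by (simp add: B_def)
    then show False
      using head_neq_s e by (metis rtranclE arcs_endsE)
  qed
  let ?out = "{a \<in> arcs G. tail G a \<in> B}" and ?in = "{a \<in> arcs G. head G a \<in> B}"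
  have "(\<Sum>a\<in>?in. x a) = (\<Sum>v\<in>B. \<Sum>a\<in>in_arcs G v. x a)"
    by (rule sum_in_arcs[OF fin, symmetric])
  also have "\<dots> \<le> (\<Sum>v\<in>B. (\<Sum>a\<in>out_arcs G v. x a) + (if v = t then u0 else 0))"
    using \<open>B \<subseteq> verts G\<close> \<open>s \<notin> B\<close> by (intro sum_mono excess) auto
  also have "\<dots> = (\<Sum>a\<in>?out. x a) + (\<Sum>v\<in>B. if v = t then u0 else 0)"
    by (simp add: sum.distrib sum_out_arcs[OF fin])
  also have "(\<Sum>v\<in>B. if v = t then u0 else 0) \<le> u0"
    using u0_nonneg fin by (simp add: sum.delta)
  finally have "(\<Sum>a\<in>?in. x a) \<le> (\<Sum>a\<in>?out. x a) + u0" by simp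
  moreover have "(\<Sum>a\<in>?out. x a) = (\<Sum>a\<in>?out \<inter> E'. x a)"
    using supp by (intro sum.mono_neutral_right) auto
  \<comment> \<open>The arc \<open>e\<close> enters \<open>B\<close> from outside, so it is not
    among the arcs with tail in \<open>B\<close>; those of them in \<open>E'\<close> end in
    \<open>B\<close> again. Both terms thus count towards the inflow, and the common sum
    cancels.\<close>
  moreover have "x e + (\<Sum>a\<in>?out \<inter> E'. x a) \<le> (\<Sum>a\<in>?in. x a)"
  proof -
    have "x e + (\<Sum>a\<in>?out \<inter> E'. x a) = (\<Sum>a\<in>insert e (?out \<inter> E'). x a)"
      using tail_notin by simp
    also have "\<dots> \<le> (\<Sum>a\<in>?in. x a)"
      using closed e E'_sub nonneg by (intro sum_mono2) (auto simp: B_def)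
    finally show ?thesis .
  qed
  ultimately show ?thesis by simp
qed

section \<open>Static flows and their true labels\<close>

text \<open>The balances of all vertices add up to 0, since each arc counts once at its tail and
  once at its head. Hence the balance at \<open>s\<close> follows from the others.\<close>

lemma static_flowI:
  assumes nonneg: "\<And>e. 0 \<le> x e" and supp: "\<And>e. e \<notin> E' \<Longrightarrow> x e = 0"
    and conserv: "\<And>v. v \<in> verts G \<Longrightarrow> v \<noteq> s \<Longrightarrow>
      (\<Sum>e\<in>in_arcs G v. x e) = (\<Sum>e\<in>out_arcs G v. x e) + (if v = t then u0 else 0)"
  shows "x \<in> static_flows G s t E' u0"
proof -
  let ?d = "\<lambda>v. (\<Sum>e\<in>out_arcs G v. x e) - (\<Sum>e\<in>in_arcs G v. x e)"
  have "(\<Sum>v\<in>verts G. ?d v) = 0"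
    using sum_out_arcs[of "verts G" x] sum_in_arcs[of "verts G" x]
    by (simp add: sum_subtractf cong: conj_cong)
  moreover have "(\<Sum>v\<in>verts G. ?d v) = ?d s + (\<Sum>v\<in>verts G - {s}. ?d v)"
    using s_in by (simp add: sum.remove)
  moreover have "(\<Sum>v\<in>verts G - {s}. ?d v) = (\<Sum>v\<in>verts G - {s}. if v = t then - u0 else 0)"
    by (rule sum.cong) (auto simp: conserv)
  moreover have "\<dots> = - u0"
    using t_in s_neq_t by (simp add: sum.delta)
  ultimately have "?d s = u0" by simp
  then show ?thesis
    using assms by (auto simp: static_flows_def)
qed

text \<open>
  A vertex carrying no flow may have \<open>l\<close> strictly below its label. Along flow-carrying arcs the two
  agree, and the thin flow condition concerns no other arcs.
\<close>

lemma normalized_thin_flowI: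
  assumes flow: "x \<in> static_flows G s t E' u0" and ls: "l s = 1"
    and le: "\<And>e. e \<in> E' \<Longrightarrow> l (head G e) \<le> edge_label \<nu> Estar e (l (tail G e)) (x e)"
    and eq: "\<And>e. e \<in> E' \<Longrightarrow> 0 < x e \<Longrightarrow>
      l (head G e) = edge_label \<nu> Estar e (l (tail G e)) (x e)"
  shows "normalized_thin_flow G \<nu> s t u0 Estar E' x"
proof -
  have nonneg: "0 \<le> x e" if "e \<in> E'" for e
    using flow that E'_sub by (auto simp: static_flows_def)
  have supp: "x e = 0" if "e \<notin> E'" for e
    using flow that by (auto simp: static_flows_def)
  obtain l' where l': "is_labels G \<nu> s Estar E' x l'"
    using labels_well_defined[OF digraph_axioms E'_sub acyclic_E'] by blast
  have mono: "edge_label \<nu> Estar e a c \<le> edge_label \<nu> Estar e b c" if "a \<le> b" for e a b c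
    using that by (auto simp: edge_label_def)
  define \<rho> where "\<rho> e = edge_label \<nu> Estar e (l' (tail G e)) (x e)" for e
  have l'_Min: "l' w = Min (\<rho> ` in_arcs H w)" if "w \<in> verts G" "w \<noteq> s" for w
    using l' that by (simp add: is_labels_def \<rho>_def)
  have l'_le: "l' (head G e) \<le> \<rho> e" if "e \<in> E'" for e
    using that by (simp add: l'_Min ends_in_verts head_neq_s H.finite_in_arcs)
  \<comment> \<open>Induction along arcs: \<open>l' v\<close> is attained at some incoming arc, and
    \<open>edge_label\<close> is monotone in the label of the tail.\<close>
  have ge: "l v \<le> l' v" if "v \<in> verts G" for v
    using wf_arcs_ends that
  proof (induction v rule: wf_induct_rule)
    case (less v)
    show ?case
    proof (cases "v = s")
      case True
      then show ?thesis using ls l' by (simp add: is_labels_def)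
    next
      case False
      obtain a where "a \<in> E'" "head G a = v"
        using in_arc_exists[OF less.prems False] .
      then have "in_arcs H v \<noteq> {}" by (auto simp: in_arcs_def)
      then have "Min (\<rho> ` in_arcs H v) \<in> \<rho> ` in_arcs H v"
        by (intro Min_in) (auto simp: H.finite_in_arcs)
      then have "l' v \<in> \<rho> ` in_arcs H v"
        by (simp only: l'_Min[OF less.prems False])
      then obtain e where e: "e \<in> E'" "head G e = v" "l' v = \<rho> e"
        by (auto simp: in_arcs_def)
      then have "l (tail G e) \<le> l' (tail G e)"
        using less.IH arc_ends ends_in_verts by blast
      then show ?thesis
        using le[OF e(1)] mono e unfolding \<rho>_def by (metis order_trans)
    qed
  qed
  define active where "active v \<longleftrightarrow> v = s \<or> (\<exists>e\<in>E'. head G e = v \<and> 0 < x e)" for v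
  \<comment> \<open>If no flow enters a vertex other than \<open>s\<close>, its net outflow is 0 or
    \<open>- u0\<close>, so nothing can leave it.\<close>
  have active_tail: "active (tail G e)" if e: "e \<in> E'" "0 < x e" for e
  proof (rule ccontr)
    let ?u = "tail G e"
    assume neg: "\<not> active ?u"
    then have "x a = 0" if "a \<in> in_arcs G ?u" for a
      using that nonneg[of a] supp[of a] by (cases "a \<in> E'") (force simp: active_def)+
    then have "(\<Sum>a\<in>in_arcs G ?u. x a) = 0" by simp
    moreover have "?u \<noteq> s" using neg by (simp add: active_def)
    ultimately have "(\<Sum>a\<in>out_arcs G ?u. x a) \<le> 0"
      using flow ends_in_verts(1)[OF e(1)] u0_nonneg by (auto simp: static_flows_def)
    moreover have "x e \<le> (\<Sum>a\<in>out_arcs G ?u. x a)"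
      using e E'_sub flow by (intro member_le_sum) (auto simp: static_flows_def)
    ultimately show False using e by simp
  qed
  \<comment> \<open>Induction along flow-carrying arcs: \<open>eq\<close> on such an arc gives
    \<open>l' v \<le> l v\<close>, and \<open>ge\<close> gives the converse.\<close>
  have agree: "l' v = l v" if "v \<in> verts G" "active v" for v
    using wf_arcs_ends that
  proof (induction v rule: wf_induct_rule)
    case (less v)
    show ?case
    proof (cases "v = s")
      case True
      then show ?thesis using ls l' by (simp add: is_labels_def)
    next
      case False
      then obtain e where e: "e \<in> E'" "head G e = v" "0 < x e"
        using less.prems by (auto simp: active_def)
      then have "l' (tail G e) = l (tail G e)"
        using less.IH arc_ends[OF e(1)] active_tail ends_in_verts by blast
      then have "l' v \<le> l v"
        using l'_le[OF e(1)] eq[OF e(1,3)] e by (simp add: \<rho>_def)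
      then show ?thesis using ge[OF less.prems(1)] by simp
    qed
  qed
  have "x e = 0" if e: "e \<in> E'" "l' (head G e) < \<rho> e" for e
  proof (rule ccontr)
    assume "x e \<noteq> 0"
    then have pos: "0 < x e" using nonneg e by force
    then have "active (head G e)" using e by (auto simp: active_def)
    then have "\<rho> e = l' (head G e)"
      using agree active_tail[OF e(1) pos] eq[OF e(1) pos] ends_in_verts[OF e(1)]
      by (simp add: \<rho>_def)
    with e show False by simp
  qed
  with flow l' show ?thesis
    by (auto simp: normalized_thin_flow_def \<rho>_def)
qed

section \<open>Solving the thin flow complementarity problem\<close>

text \<open>
  The unknowns are a label \<open>l v = L * y (Inl v)\<close> for each vertex \<open>v \<noteq> s\<close> and a rate \<open>\<theta> e = y (Inr e)\<close>
  for each arc, with \<open>x e = \<nu> e * \<theta> e * l (head G e)\<close>. Complementarity for \<open>\<theta> e\<close> is the label condition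
  on \<open>e\<close>, complementarity for \<open>l v\<close> is flow conservation at \<open>v\<close> as long as \<open>l v < L\<close>.
\<close>

lemma thin_flow_up_to_idle_vertices:
  obtains x l where "x \<in> static_flows G s t E' u0" and "l s = 1"
    and "\<And>e. e \<in> E' \<Longrightarrow> l (head G e) \<le> edge_label \<nu> Estar e (l (tail G e)) (x e)"
    and "\<And>e. e \<in> E' \<Longrightarrow> 0 < x e \<Longrightarrow>
      l (head G e) = edge_label \<nu> Estar e (l (tail G e)) (x e)"
proof -
  \<comment> \<open>Bounds the head label of every arc with rate 1: there the label is
    \<open>x e / \<nu> e\<close> with \<open>x e \<le> u0\<close>. Later \<open>L\<close> exceeds
    both \<open>C\<close> and the label 1 of \<open>s\<close>.\<close>
  define C where "C = (\<Sum>e\<in>E'. u0 / \<nu> e)"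
  have pos: "0 < \<nu> e" if "e \<in> E'" for e
    using that E'_sub \<nu>_pos by auto
  have u0_le_C: "u0 / \<nu> e \<le> C" if "e \<in> E'" for e
    unfolding C_def using that finite_E' pos u0_nonneg
    by (intro member_le_sum) (auto simp: less_imp_le)
  have C_nonneg: "0 \<le> C"
    unfolding C_def using pos u0_nonneg by (intro sum_nonneg) (auto simp: less_imp_le)
  define L where "L = 2 + C"
  have L: "1 < L" "C < L" "0 < L" using C_nonneg by (auto simp: L_def)
  \<comment> \<open>A resetting arc has rate 1 throughout, which forces its head label to be
    \<open>x e / \<nu> e\<close> whatever the tail label is.\<close>
  define \<theta> where "\<theta> y e = (if e \<in> Estar then 1 else y (Inr e))" for y :: "'a + 'b \<Rightarrow> real" and e
  define lab where "lab y v = (if v = s then 1 else L * y (Inl v))" for y :: "'a + 'b \<Rightarrow> real" and v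
  define fl where "fl y e = (if e \<in> E' then \<nu> e * \<theta> y e * lab y (head G e) else 0)" for y e
  define bal where "bal y v = (\<Sum>e\<in>out_arcs G v. fl y e) + (if v = t then u0 else 0)
    - (\<Sum>e\<in>in_arcs G v. fl y e)" for y v
  define g where "g i y = (case i of Inl v \<Rightarrow> bal y v
    | Inr e \<Rightarrow> lab y (head G e) - lab y (tail G e))" for i y
  have "continuous_on UNIV (\<lambda>y. \<theta> y e)" for e
    by (cases "e \<in> Estar") (simp_all add: \<theta>_def)
  moreover have cont_lab: "continuous_on UNIV (\<lambda>y. lab y v)" for v
    by (cases "v = s") (simp_all add: lab_def continuous_on_mult_left)
  ultimately have "continuous_on UNIV (\<lambda>y. fl y e)" for e
    by (cases "e \<in> E'") (simp_all add: fl_def continuous_on_mult continuous_on_mult_left)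
  then have "continuous_on UNIV (\<lambda>y. bal y v)" for v
    unfolding bal_def by (intro continuous_intros)
  with cont_lab have cont_g: "continuous_on UNIV (g i)" for i
    by (cases i) (auto simp: g_def[abs_def] intro!: continuous_intros)
  \<comment> \<open>The source gets no coordinate: its label is fixed at 1 and its balance follows
    from the others.\<close>
  have "finite (Inl ` (verts G - {s}) \<union> Inr ` E')"
    using finite_E' by simp
  then obtain y where box: "\<And>i. y i \<in> {0..1}"
    and ge0: "\<And>i. i \<in> Inl ` (verts G - {s}) \<union> Inr ` E' \<Longrightarrow> 0 < y i \<Longrightarrow> 0 \<le> g i y"
    and le0: "\<And>i. i \<in> Inl ` (verts G - {s}) \<union> Inr ` E' \<Longrightarrow> y i < 1 \<Longrightarrow> g i y \<le> 0"
    using cube_complementarity[where g = g] cont_g by metis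
  define x where "x = fl y"
  define l where "l = lab y"
  have ls: "l s = 1" by (simp add: l_def lab_def)
  have l_nonneg: "0 \<le> l v" for v
    using box[of "Inl v"] L by (simp add: l_def lab_def)
  have \<theta>01: "0 \<le> \<theta> y e" "\<theta> y e \<le> 1" for e
    using box[of "Inr e"] by (auto simp: \<theta>_def)
  have x_E': "x e = \<nu> e * \<theta> y e * l (head G e)" if "e \<in> E'" for e
    using that by (simp add: x_def fl_def l_def)
  have supp: "x e = 0" if "e \<notin> E'" for e
    using that by (simp add: x_def fl_def)
  have nonneg: "0 \<le> x e" for e
    using x_E' supp pos \<theta>01 l_nonneg by (cases "e \<in> E'") (simp_all add: less_imp_le)
  have arc_rise: "\<theta> y e = 1" if "e \<in> E'" "e \<in> Estar \<or> l (tail G e) < l (head G e)" for e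
    using that le0[of "Inr e"] box[of "Inr e"] by (fastforce simp: g_def l_def \<theta>_def)
  have arc_drop: "\<theta> y e = 0" if "e \<in> E'" "e \<notin> Estar" "l (head G e) < l (tail G e)" for e
    using that ge0[of "Inr e"] box[of "Inr e"] by (fastforce simp: g_def l_def \<theta>_def)
  \<comment> \<open>At label 0 complementarity gives no lower bound, but then every incoming arc has
    zero flow.\<close>
  have bal_ge: "0 \<le> bal y v" if v: "v \<in> verts G" "v \<noteq> s" for v
  proof (cases "0 < y (Inl v)")
    case True
    then show ?thesis using ge0[of "Inl v"] v by (simp add: g_def)
  next
    case False
    then have "l v = 0" using box[of "Inl v"] v by (simp add: l_def lab_def)
    then have "x e = 0" if "e \<in> in_arcs G v" for e
      using that x_E' supp by (cases "e \<in> E'") auto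
    then have "(\<Sum>e\<in>in_arcs G v. x e) = 0" by simp
    then show ?thesis
      using nonneg u0_nonneg by (simp add: bal_def sum_nonneg flip: x_def)
  qed
  \<comment> \<open>The one-sided balance already bounds the flow. This bounds the labels, which
    makes the upper faces inactive and only then yields conservation.\<close>
  have x_le: "x e \<le> u0" if "e \<in> E'" for e
  proof (rule flow_le_u0[OF nonneg supp _ that])
    show "(\<Sum>e\<in>in_arcs G v. x e) \<le> (\<Sum>e\<in>out_arcs G v. x e) + (if v = t then u0 else 0)"
      if "v \<in> verts G" "v \<noteq> s" for v
      using bal_ge[OF that] by (simp add: bal_def flip: x_def)
  qed
  \<comment> \<open>Either the arc has rate 1 and its head label is at most \<open>C\<close>, or the
    label does not rise along it.\<close>
  have l_step: "l (head G e) \<le> max (l (tail G e)) C" if e: "e \<in> E'" for e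
  proof (cases "e \<in> Estar \<or> l (tail G e) < l (head G e)")
    case True
    then have "\<nu> e * l (head G e) \<le> u0"
      using x_le[OF e] x_E'[OF e] arc_rise[OF e] by simp
    then have "l (head G e) \<le> u0 / \<nu> e"
      using pos[OF e] by (simp add: field_simps)
    then show ?thesis using u0_le_C[OF e] by simp
  qed auto
  have l_less: "l v < L" if "v \<in> verts G" for v
  proof -
    have "l v \<le> max 1 C"
      using rtrancl_from_s[OF that]
    proof (induction rule: rtrancl_induct)
      case (step v w)
      then show ?case using l_step by (fastforce elim!: arcs_endsE)
    qed (simp add: ls)
    then show ?thesis using L by simp
  qed
  have conserv: "(\<Sum>e\<in>in_arcs G v. x e) = (\<Sum>e\<in>out_arcs G v. x e) + (if v = t then u0 else 0)"
    if v: "v \<in> verts G" "v \<noteq> s" for v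
  proof -
    have "y (Inl v) < 1"
      using l_less[OF v(1)] v(2) L by (simp add: l_def lab_def)
    then have "bal y v \<le> 0"
      using le0[of "Inl v"] v by (simp add: g_def)
    then show ?thesis
      using bal_ge[OF v] by (simp add: bal_def flip: x_def)
  qed
  \<comment> \<open>On a non-resetting arc, a rising label forces rate 1 and a falling one forces
    zero flow. For equal labels \<open>div_le\<close> makes the maximum equal to the tail
    label.\<close>
  have lab_le: "l (head G e) \<le> edge_label \<nu> Estar e (l (tail G e)) (x e)"
    and lab_eq: "0 < x e \<Longrightarrow> l (head G e) = edge_label \<nu> Estar e (l (tail G e)) (x e)"
    if e: "e \<in> E'" for e
  proof -
    have div: "x e / \<nu> e = \<theta> y e * l (head G e)"
      using pos[OF e] x_E'[OF e] by simp
    also have "\<dots> \<le> l (head G e)"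
      using \<theta>01 l_nonneg by (simp add: mult_left_le_one_le)
    finally have div_le: "x e / \<nu> e \<le> l (head G e)" .
    show "l (head G e) \<le> edge_label \<nu> Estar e (l (tail G e)) (x e)"
      using arc_rise[OF e] div by (force simp: edge_label_def max_def)
    show "l (head G e) = edge_label \<nu> Estar e (l (tail G e)) (x e)" if "0 < x e"
      using that arc_rise[OF e] arc_drop[OF e] div div_le x_E'[OF e]
      by (cases "e \<in> Estar"; cases "l (tail G e)" "l (head G e)" rule: linorder_cases)
        (auto simp: edge_label_def max_def)
  qed
  show thesis
    using that[of x l] static_flowI[OF nonneg supp conserv] ls lab_le lab_eq by blast
qed

end

theorem theorem8:
  fixes G :: "('a, 'b) pre_digraph" and s t :: 'a and \<nu> :: "'b \<Rightarrow> real"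
    and u0 :: real and Estar E' :: "'b set"
  assumes "digraph G"
    and "s \<in> verts G" "t \<in> verts G" "s \<noteq> t"
    and "\<forall>e\<in>arcs G. 0 < \<nu> e"
    and "0 \<le> u0"
    and "Estar \<subseteq> E'" "E' \<subseteq> arcs G"
    and "acyclic_digraph (edge_subgraph G E')"
    and "\<forall>v\<in>verts G. \<exists>p. pre_digraph.apath (edge_subgraph G E') s p v"
  shows "\<exists>x. normalized_thin_flow G \<nu> s t u0 Estar E' x"
proof -
  interpret digraph G by fact
  interpret thin_flow_network G s t \<nu> u0 Estar E'
    using assms(2-) by unfold_locales auto
  show ?thesis
    by (rule thin_flow_up_to_idle_vertices) (rule exI, rule normalized_thin_flowI)
qed

end
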